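(* Let $H$ be a simple graph and let $G=2H$ be the signed graph obtained from $H$ by replacing every edge of $H$ by a pair of parallel edges, one positive and one negative. Then $\chi^{\pm}(G)=2\chi(H)-1$.
   Context: A signed graph is a finite graph (multiple edges allowed, no loops) together with a sign map $\sigma$ assigning $+1$ or $-1$ to each edge. A coloring of a signed graph $G$ is a map $\phi:V(G)\to\mathbb{Z}$ such that every edge $e$ with ends $v,w$ satisfies $\phi(v)\neq\sigma(e)\phi(w)$. For an integer $h\ge 0$ let $Z_{2h}=\{\pm1,\pm2,\dots,\pm h\}$ and $Z_{2h+1}=Z_{2h}\cup\{0\}$. The signed chromatic number $\chi^{\pm}(G)$ is the least integer $k$ such that $G$ has a coloring $\phi$ with $\phi(V(G))\subseteq Z_k$. $\chi(H)$ is the ordinary chromatic number. *)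

theory Defs
  imports Main
begin

record 'v graph =
  verts :: "'v set"
  edges :: "'v set set"

definition simple_graph :: "'v graph \<Rightarrow> bool" where
  "simple_graph H \<longleftrightarrow>
     finite (verts H) \<and> (\<forall>e \<in> edges H. e \<subseteq> verts H \<and> card e = 2)"

definition proper_coloring :: "'v graph \<Rightarrow> ('v \<Rightarrow> nat) \<Rightarrow> bool" where
  "proper_coloring H f \<longleftrightarrow> (\<forall>v w. {v, w} \<in> edges H \<longrightarrow> f v \<noteq> f w)"

definition chromatic_number :: "'v graph \<Rightarrow> nat" where
  "chromatic_number H = (LEAST k. \<exists>f. proper_coloring H f \<and> f ` verts H \<subseteq> {..<k})"

text \<open>Edges of a signed graph are abstract identifiers, so that parallel edges are possible.\<close>

record ('v, 'e) signed_graph =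
  sverts :: "'v set"
  sedges :: "'e set"
  ends :: "'e \<Rightarrow> 'v set"
  sign :: "'e \<Rightarrow> int"

definition wf_signed_graph :: "('v, 'e) signed_graph \<Rightarrow> bool" where
  "wf_signed_graph G \<longleftrightarrow>
     finite (sverts G) \<and> finite (sedges G) \<and>
     (\<forall>e \<in> sedges G. ends G e \<subseteq> sverts G \<and> card (ends G e) = 2 \<and> sign G e \<in> {1, -1})"

definition signed_coloring :: "('v, 'e) signed_graph \<Rightarrow> ('v \<Rightarrow> int) \<Rightarrow> bool" where
  "signed_coloring G \<phi> \<longleftrightarrow>
     (\<forall>e \<in> sedges G. \<forall>v w. ends G e = {v, w} \<longrightarrow> \<phi> v \<noteq> sign G e * \<phi> w)"

definition signed_colors :: "nat \<Rightarrow> int set" where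
  "signed_colors k =
     {c. 1 \<le> \<bar>c\<bar> \<and> \<bar>c\<bar> \<le> int (k div 2)} \<union> (if odd k then {0} else {})"

lemma signed_colors_even: "signed_colors (2 * h) = {c. 1 \<le> \<bar>c\<bar> \<and> \<bar>c\<bar> \<le> int h}"
  by (simp add: signed_colors_def)

lemma signed_colors_odd: "signed_colors (2 * h + 1) = signed_colors (2 * h) \<union> {0}"
  by (simp add: signed_colors_def)

definition signed_chromatic_number :: "('v, 'e) signed_graph \<Rightarrow> nat" where
  "signed_chromatic_number G =
     (LEAST k. \<exists>\<phi>. signed_coloring G \<phi> \<and> \<phi> ` sverts G \<subseteq> signed_colors k)"

text \<open>The signed graph \<open>2H\<close>: each edge \<open>e\<close> of \<open>H\<close> yields the parallel edges \<open>(e, 1)\<close> and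
  \<open>(e, -1)\<close>, whose signs are their second components.\<close>

definition double_graph :: "'v graph \<Rightarrow> ('v, 'v set \<times> int) signed_graph" where
  "double_graph H =
     \<lparr>sverts = verts H, sedges = edges H \<times> {1, -1}, ends = fst, sign = snd\<rparr>"

lemma wf_double_graph:
  assumes "simple_graph H"
  shows "wf_signed_graph (double_graph H)"
proof -
  have "edges H \<subseteq> Pow (verts H)" "finite (verts H)"
    using assms by (auto simp: simple_graph_def)
  then have "finite (edges H)"
    by (meson finite_Pow_iff finite_subset)
  then show ?thesis
    using assms by (auto simp: simple_graph_def wf_signed_graph_def double_graph_def)
qed

end

theory Submission imports Defs begin

text \<open>Adjacent vertices of \<open>2H\<close> have colors different in absolute value, and this is all that a
  coloring of \<open>2H\<close> requires. As \<open>Z\<^sub>k\<close> has \<open>(k + 1) div 2\<close> absolute values, \<open>Z\<^sub>k\<close> suffices for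
  \<open>2H\<close> iff \<open>(k + 1) div 2\<close> colors suffice for \<open>H\<close>.\<close>

lemma signed_coloring_double_graph_iff:
  "signed_coloring (double_graph H) \<phi> \<longleftrightarrow> proper_coloring H (\<lambda>v. nat \<bar>\<phi> v\<bar>)"
proof -
  have abs_ne: "nat \<bar>a\<bar> \<noteq> nat \<bar>b\<bar> \<longleftrightarrow> a \<noteq> b \<and> a \<noteq> - b" for a b :: int
    by linarith
  \<comment> \<open>The positive copy of an edge forbids equal colors at its ends, the negative copy
    forbids opposite ones.\<close>
  have "signed_coloring (double_graph H) \<phi> \<longleftrightarrow>
      (\<forall>v w. {v, w} \<in> edges H \<longrightarrow> \<phi> v \<noteq> \<phi> w \<and> \<phi> v \<noteq> - \<phi> w)"
    unfolding signed_coloring_def double_graph_def by fastforce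
  then show ?thesis
    unfolding proper_coloring_def abs_ne .
qed

text \<open>Truncated subtraction identifies only 0 and 1, so it keeps distinct colors distinct once
  0 is avoided. This serves the palettes without 0, those of even size.\<close>

lemma proper_coloring_pred:
  assumes "simple_graph H" "proper_coloring H f" "\<forall>v \<in> verts H. f v \<noteq> 0"
  shows "proper_coloring H (\<lambda>v. f v - 1)"
  unfolding proper_coloring_def
proof (intro allI impI)
  fix v w assume vw: "{v, w} \<in> edges H"
  then have "f v \<noteq> f w" "v \<in> verts H" "w \<in> verts H"
    using assms by (auto simp: proper_coloring_def simple_graph_def)
  then show "f v - 1 \<noteq> f w - 1"
    using assms(3) by (metis One_nat_def Suc_pred neq0_conv)
qed

lemma chromatic_number_le:
  "proper_coloring H f \<Longrightarrow> f ` verts H \<subseteq> {..<k} \<Longrightarrow> chromatic_number H \<le> k"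
  unfolding chromatic_number_def by (rule Least_le) blast

text \<open>The minimum is attained because some finite palette works: number the vertices
  injectively.\<close>

lemma chromatic_number_coloring:
  assumes "simple_graph H"
  obtains f where "proper_coloring H f" "f ` verts H \<subseteq> {..<chromatic_number H}"
proof -
  have "finite (verts H)"
    using assms by (simp add: simple_graph_def)
  then obtain f :: "'a \<Rightarrow> nat" and n where f: "f ` verts H = {i. i < n}" "inj_on f (verts H)"
    using finite_imp_inj_to_nat_seg by blast
  have "f v \<noteq> f w" if "{v, w} \<in> edges H" for v w
  proof -
    \<comment> \<open>Cardinality 2 rules out \<open>v = w\<close>, so injectivity of
      \<open>f\<close> applies.\<close>
    have "v \<in> verts H" "w \<in> verts H" "card {v, w} = 2"
      using assms that by (auto simp: simple_graph_def)
    then show ?thesis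
      using f(2) by (auto simp: inj_on_eq_iff)
  qed
  then have "\<exists>f. proper_coloring H f \<and> f ` verts H \<subseteq> {..<n}"
    using f(1) by (intro exI[of _ f]) (auto simp: proper_coloring_def)
  then have "\<exists>f. proper_coloring H f \<and> f ` verts H \<subseteq> {..<chromatic_number H}"
    unfolding chromatic_number_def by (rule LeastI)
  then show ?thesis
    using that by blast
qed

lemma chromatic_number_le_of_signed_coloring:
  assumes H: "simple_graph H"
    and col: "signed_coloring (double_graph H) \<phi>" and sub: "\<phi> ` verts H \<subseteq> signed_colors k"
  shows "chromatic_number H \<le> (k + 1) div 2"
proof (cases "odd k")
  case True
  \<comment> \<open>The palette contains 0, so the absolute values range over
    \<open>0, ..., k div 2\<close> and can serve directly as colors.\<close>
  have "nat \<bar>\<phi> v\<bar> < (k + 1) div 2" if "v \<in> verts H" for v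
  proof -
    have "\<bar>\<phi> v\<bar> \<le> int (k div 2)"
      using sub that by (auto simp: signed_colors_def split: if_splits)
    moreover have "(k + 1) div 2 = k div 2 + 1"
      using True by presburger
    ultimately show ?thesis
      by linarith
  qed
  then show ?thesis
    using col by (intro chromatic_number_le) (auto simp: signed_coloring_double_graph_iff)
next
  case False
  have bounds: "1 \<le> \<bar>\<phi> v\<bar>" "\<bar>\<phi> v\<bar> \<le> int (k div 2)" if "v \<in> verts H" for v
    using sub that False by (auto simp: signed_colors_def)
  \<comment> \<open>Here the absolute values start at 1; shifting them down by one saves a
    color.\<close>
  have "proper_coloring H (\<lambda>v. nat \<bar>\<phi> v\<bar> - 1)"
    using H col bounds by (intro proper_coloring_pred) (force simp: signed_coloring_double_graph_iff)+
  moreover have "nat \<bar>\<phi> v\<bar> - 1 < (k + 1) div 2" if "v \<in> verts H" for v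
    using bounds[OF that] by linarith
  ultimately show ?thesis
    by (intro chromatic_number_le) auto
qed

theorem theorem3:
  fixes H :: "'v graph"
  assumes "simple_graph H" and "verts H \<noteq> {}"
  shows "int (signed_chromatic_number (double_graph H)) = 2 * int (chromatic_number H) - 1"
proof -
  obtain f where f: "proper_coloring H f" "f ` verts H \<subseteq> {..<chromatic_number H}"
    using chromatic_number_coloring[OF assms(1)] .
  \<comment> \<open>A vertex needs a color. Positivity makes
    \<open>2 * chromatic_number H - 1\<close> the same over the naturals as over the integers; for
    the empty graph both chromatic numbers would be 0.\<close>
  then have pos: "chromatic_number H > 0"
    using assms(2) by fastforce
  have "signed_chromatic_number (double_graph H) = 2 * chromatic_number H - 1"
    unfolding signed_chromatic_number_def
  proof (rule Least_equality)
    have half: "(2 * chromatic_number H - 1) div 2 = chromatic_number H - 1"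
      "odd (2 * chromatic_number H - 1)"
      using pos by presburger+
    \<comment> \<open>An optimal coloring of \<open>H\<close> is reused unchanged: its colors are
      nonnegative, hence equal to their absolute values, and 0 is allowed in an odd palette.\<close>
    have "signed_coloring (double_graph H) (\<lambda>v. int (f v))"
      using f(1) by (simp add: signed_coloring_double_graph_iff)
    moreover have "int (f v) \<in> signed_colors (2 * chromatic_number H - 1)" if "v \<in> verts H" for v
    proof -
      have "f v < chromatic_number H"
        using f(2) that by blast
      then show ?thesis
        using half by (auto simp: signed_colors_def)
    qed
    ultimately show "\<exists>\<phi>. signed_coloring (double_graph H) \<phi> \<and>
        \<phi> ` sverts (double_graph H) \<subseteq> signed_colors (2 * chromatic_number H - 1)"
      by (intro exI[of _ "\<lambda>v. int (f v)"]) (auto simp: double_graph_def)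
  next
    fix k
    assume "\<exists>\<phi>. signed_coloring (double_graph H) \<phi> \<and>
      \<phi> ` sverts (double_graph H) \<subseteq> signed_colors k"
    then have "chromatic_number H \<le> (k + 1) div 2"
      using chromatic_number_le_of_signed_coloring[OF assms(1)] by (auto simp: double_graph_def)
    then show "2 * chromatic_number H - 1 \<le> k"
      by linarith
  qed
  then show ?thesis
    using pos by simp
qed

end
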